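(* Let $n\in\mathbb{N}$ and $T\in\operatorname{YT}(n)$. If $n\ge 8$, then $\operatorname{M}_2(T)$ determines $T$; that is, for $S,T\in\operatorname{YT}(n)$ with $n\ge 8$, $\operatorname{M}_2(S)=\operatorname{M}_2(T)$ implies $S=T$.
   Context: $\mathbb{N}=\{1,2,\dots\}$. A (standard Young) tableau of shape $\lambda$ (a partition of $n$) is a filling of the Young diagram of $\lambda$ by distinct elements of $[1,n]$ increasing strictly along rows and down columns; $\operatorname{YT}(n)$ is the set of such tableaux with entries exactly $[1,n]$. Deletion by jeu de taquin: for $T\in\operatorname{YT}(n)$ and an entry $m$, delete the cell containing $m$; repeatedly, if there is a cell directly to the right of or directly below the empty space, slide the one with the smaller entry into it; stop when neither exists; then subtract 1 from every entry larger than $m$, giving $T-m\in\operatorname{YT}(n-1)$. A $2$-minor of $T$ is a tableau obtained by two successive such deletions; $\operatorname{M}_2(T)$ is the set of all $2$-minors of $T$. *)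

theory Defs
  imports Main
begin

text \<open>Cells are pairs (row, column), both counted from 0, rows running downwards.\<close>

type_synonym cell = "nat \<times> nat"
type_synonym filling = "cell \<Rightarrow> nat option"

definition is_partition :: "nat \<Rightarrow> nat list \<Rightarrow> bool" where
  "is_partition n p \<longleftrightarrow> sorted_wrt (\<ge>) p \<and> 0 \<notin> set p \<and> sum_list p = n"

definition young_diagram :: "nat list \<Rightarrow> cell set" where
  "young_diagram p = {(i, j). i < length p \<and> j < p ! i}"

definition tableau_of_shape :: "nat list \<Rightarrow> filling \<Rightarrow> bool" where
  "tableau_of_shape p T \<longleftrightarrow>
     dom T = young_diagram p \<and>
     inj_on T (dom T) \<and>
     (\<forall>i j j' a b. j < j' \<longrightarrow> T (i, j) = Some a \<longrightarrow> T (i, j') = Some b \<longrightarrow> a < b) \<and>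
     (\<forall>i i' j a b. i < i' \<longrightarrow> T (i, j) = Some a \<longrightarrow> T (i', j) = Some b \<longrightarrow> a < b)"

definition YT :: "nat \<Rightarrow> filling set" where
  "YT n = {T. \<exists>p. is_partition n p \<and> tableau_of_shape p T \<and> ran T = {1..n}}"

text \<open>\<open>jdt T i j\<close> performs the slides, the empty space being at \<open>(i, j)\<close>. On a filling with
  finitely many cells the recursion terminates, since the empty space moves right or down into
  an occupied cell at every step; tail recursion spares restricting the definition to these.\<close>

partial_function (tailrec) jdt :: "filling \<Rightarrow> nat \<Rightarrow> nat \<Rightarrow> filling" where
  "jdt T i j =
     (case T (i, Suc j) of
        None \<Rightarrow>
          (case T (Suc i, j) of
             None \<Rightarrow> T
           | Some b \<Rightarrow> jdt (T((i, j) := Some b, (Suc i, j) := None)) (Suc i) j)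
      | Some a \<Rightarrow>
          (case T (Suc i, j) of
             None \<Rightarrow> jdt (T((i, j) := Some a, (i, Suc j) := None)) i (Suc j)
           | Some b \<Rightarrow>
               if a < b
               then jdt (T((i, j) := Some a, (i, Suc j) := None)) i (Suc j)
               else jdt (T((i, j) := Some b, (Suc i, j) := None)) (Suc i) j))"

definition delete_entry :: "filling \<Rightarrow> nat \<Rightarrow> filling" where
  "delete_entry T m =
     (let (i, j) = (THE c. T c = Some m);
          T' = jdt (T((i, j) := None)) i j
      in (\<lambda>c. map_option (\<lambda>k. if m < k then k - 1 else k) (T' c)))"

text \<open>The entries of a filling \<open>T\<close> are the elements of \<open>ran T\<close>; for \<open>T \<in> YT n\<close> these are
  \<open>{1..n}\<close>, and those of a deletion are \<open>{1..n - 1}\<close>.\<close>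

definition M2 :: "filling \<Rightarrow> filling set" where
  "M2 T = {delete_entry (delete_entry T m) m' | m m'.
             m \<in> ran T \<and> m' \<in> ran (delete_entry T m)}"

end

theory Submission
  imports Defs
begin

text \<open>A tableau is recorded by the lattice word listing the rows of its entries \<open>1, \<dots>, n\<close>. Deletion of
  an entry erases its letter and then reads the later letters in order, lowering a letter by one
  exactly when it would violate the lattice condition. Hence deletion commutes with restriction to
  the entries \<open>1, \<dots>, k\<close>, and the 2-minors of \<open>T\<close> determine those of \<open>T\<close> without its largest entry
  \<open>n\<close>. By induction it remains to find the cell of \<open>n\<close>. If two tableaux differ only in this cell and
  have the same 2-minors, then no 2-minor of either can contain its cell of \<open>n\<close>; both shapes are then
  rectangles with at most one additional cell, and this forces \<open>n \<le> 7\<close>. The base case \<open>n = 8\<close> is a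
  finite check, organised by comparing words only if their prefixes have the same 2-minors.\<close>

section \<open>Lattice words\<close>

text \<open>Ballot (Yamanouchi) words read backwards: the tail holds the earlier letters, and a
  letter \<open>x\<close> may be added only if its cell lies in row 0 or below an occupied
  cell.\<close>

fun lattice :: "nat list \<Rightarrow> bool" where
  "lattice [] = True"
| "lattice (x # u) = (lattice u \<and> (x = 0 \<or> count_list u x < count_list u (x - 1)))"

text \<open>Words are stored with the last letter first: in a word \<open>w\<close> representing a tableau with
  \<open>length w\<close> entries, \<open>w ! i\<close> is the row of the entry \<open>length w - i\<close>, and \<open>minors w ! i\<close> represents the
  deletion of that entry. The letter decremented by \<open>push\<close> is the one whose cell lies just below the
  empty space.\<close>

definition push :: "nat \<Rightarrow> nat list \<Rightarrow> nat list" where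
  "push x v = (if 0 < x \<and> count_list v (x - 1) \<le> count_list v x then x - 1 else x) # v"

fun minors :: "nat list \<Rightarrow> nat list list" where
  "minors [] = []"
| "minors (x # u) = u # map (push x) (minors u)"

definition minors2 :: "nat list \<Rightarrow> nat list list" where
  "minors2 w = concat (map minors (minors w))"

fun fill :: "nat list \<Rightarrow> filling" where
  "fill [] = Map.empty"
| "fill (x # u) = (fill u)((x, count_list u x) \<mapsto> Suc (length u))"

lemma lattice_count_Suc_le: "lattice w \<Longrightarrow> count_list w (Suc s) \<le> count_list w s"
  by (induction w) auto

lemma lattice_count_antimono:
  assumes "lattice w"
  shows "antimono (count_list w)"
  using lattice_count_Suc_le[OF assms] by (simp add: antimono_iff_le_Suc)

lemma length_minors: "length (minors w) = length w"
  by (induction w) auto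

text \<open>Here \<open>u\<close> has one cell more than \<open>v\<close>, in row \<open>r\<close>.
  The letter \<open>x\<close> becomes illegal after \<open>v\<close> only if its cell lies directly
  below that one; it then moves up to row \<open>r\<close>, and the cell lost by the shape passes
  from row \<open>r\<close> to row \<open>x\<close>.\<close>

lemma lattice_pushI:
  assumes u: "lattice (x # u)" and v: "lattice v"
    and count: "\<And>s. count_list u s = count_list v s + of_bool (s = r)"
  obtains "x = Suc r" "count_list u x = count_list v r" "push x v = r # v"
    "lattice (push x v)"
  | "x \<noteq> Suc r \<or> count_list u x < count_list v r" "push x v = x # v" "lattice (push x v)"
proof (cases "x = Suc r \<and> count_list v r \<le> count_list v x")
  case True
  have r: "r = 0 \<or> count_list v r < count_list v (r - 1)"
    using lattice_count_Suc_le[of u "r - 1"] u count[of r] count[of "r - 1"] by (cases r) auto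
  have "count_list u x = count_list v r"
    using True u count[of x] count[of r] by auto
  moreover have "push x v = r # v"
    using True by (auto simp: push_def)
  ultimately show ?thesis
    using that(1) True r v by simp
next
  case False
  then have "\<not> (0 < x \<and> count_list v (x - 1) \<le> count_list v x)"
    using u count[of x] count[of "x - 1"] by (cases x) (auto simp: of_bool_def split: if_splits)
  then have *: "push x v = x # v" "lattice (push x v)"
    using v by (auto simp: push_def)
  show ?thesis
    using that(2) * False count[of x] by auto
qed

lemma minors_count:
  assumes "lattice w" "v \<in> set (minors w)"
  shows "lattice v \<and> Suc (length v) = length w \<and>
    (\<exists>r. \<forall>s. count_list w s = count_list v s + of_bool (s = r))"
  using assms
proof (induction w arbitrary: v)
  case (Cons x u)
  show ?case
  proof (cases "v = u")
    case True
    then show ?thesis using Cons.prems by auto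
  next
    case False
    then obtain v' where v': "v = push x v'" "v' \<in> set (minors u)"
      using Cons.prems by auto
    with Cons obtain r where r: "lattice v'" "Suc (length v') = length u"
      "\<And>s. count_list u s = count_list v' s + of_bool (s = r)"
      by (metis lattice.simps(2))
    show ?thesis
      using Cons.prems(1) r(1,3)
    proof (cases rule: lattice_pushI)
      case 1
      then show ?thesis using r v'(1) by (auto intro!: exI[of _ x])
    next
      case 2
      then show ?thesis using r v'(1) by (auto intro!: exI[of _ r])
    qed
  qed
qed simp

text \<open>The hypothesis makes the last cell of row \<open>r\<close> a corner. Deleting its entry
  triggers no slide, so exactly this cell is lost.\<close>

lemma corner_minor:
  assumes "lattice w" "count_list w (Suc r) < count_list w r"
  shows "\<exists>v\<in>set (minors w). \<forall>s. count_list w s = count_list v s + of_bool (s = r)"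
  using assms
proof (induction w)
  case (Cons x u)
  show ?case
  proof (cases "x = r")
    case False
    then have "count_list u (Suc r) < count_list u r"
      using Cons.prems by (auto split: if_splits)
    with Cons obtain v where v: "v \<in> set (minors u)"
      "\<And>s. count_list u s = count_list v s + of_bool (s = r)" by auto
    have "lattice v" using v(1) Cons.prems minors_count by auto
    with Cons.prems(1) have "push x v = x # v"
      using v(2)
    proof (cases rule: lattice_pushI)
      \<comment> \<open>A lowered \<open>x\<close> would have its cell directly below the last cell
        of row \<open>r\<close>, which would then not be a corner.\<close>
      case 1
      then show ?thesis using v(2)[of r] Cons.prems(2) by auto
    qed
    then have "x # v \<in> set (minors (x # u))"
      using v(1) by force
    then show ?thesis using v(2) by (intro bexI[of _ "x # v"]) auto
  qed auto
qed simp

text \<open>\<open>tl\<close> forgets the largest entry and \<open>push\<close> only adds a letter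
  in front, so forgetting commutes with deletion. A 2-minor that has already lost the largest entry
  of \<open>x # u\<close> is a minor of \<open>u\<close>, and its tail is a further
  deletion.\<close>

lemma tl_minors2:
  assumes "lattice u" "2 \<le> length u"
  shows "tl ` set (minors2 (x # u)) = set (minors2 u)"
proof -
  have tl_push: "tl ` push y ` A = A" for y A
    by (simp add: push_def image_image)
  \<comment> \<open>The bound on the length enters here: \<open>tl v\<close> is a deletion only if
    \<open>v\<close> has a letter.\<close>
  have ne: "v \<noteq> []" if "v \<in> set (minors u)" for v
    using minors_count[OF assms(1) that] assms(2) by auto
  have tl_in: "tl v \<in> set (minors v)" if "v \<in> set (minors u)" for v
    using ne[OF that] by (cases v) auto
  have tl_minors_push: "tl ` set (minors (push x v)) = set (minors v)" if "v \<in> set (minors u)" for v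
  proof -
    have "tl ` set (minors (push x v)) = insert (tl v) (set (minors v))"
      by (subst push_def) (simp add: tl_push)
    then show ?thesis using tl_in[OF that] by auto
  qed
  have "tl ` set (minors2 (x # u)) =
    tl ` set (minors u) \<union> (\<Union>v\<in>set (minors u). tl ` set (minors (push x v)))"
    by (simp add: minors2_def image_Un image_UN)
  also have "\<dots> = tl ` set (minors u) \<union> (\<Union>v\<in>set (minors u). set (minors v))"
    using tl_minors_push by simp
  also have "\<dots> = set (minors2 u)"
    using tl_in by (auto simp: minors2_def)
  finally show ?thesis .
qed

section \<open>The last letter\<close>

text \<open>For row lengths \<open>f\<close>, the first hypothesis says that only row
  \<open>x\<close> can end in a corner. Hence the length is constant on rows \<open>0..x\<close> and
  constant below them, and the latter constant is 0 because row \<open>N\<close> is empty.\<close>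

lemma only_corner_rectangle:
  fixes f :: "nat \<Rightarrow> nat"
  assumes "\<And>s. s \<noteq> x \<Longrightarrow> f s \<le> f (Suc s)" "antimono f" "f N = 0"
  shows "f i = (if i \<le> x then f 0 else 0)"
proof -
  have eq: "f (Suc s) = f s" if "s \<noteq> x" for s
    using assms(1)[OF that] antimonoD[OF assms(2), of s "Suc s"] by simp
  have "i \<le> x \<longrightarrow> f i = f 0" for i
    by (induction i) (use eq in auto)
  moreover have "f (Suc x + k) = f (Suc x)" for k
    by (induction k) (use eq in auto)
  then have "f i = f (Suc x)" if "x < i" for i
    using that by (metis less_imp_Suc_add add_Suc)
  moreover have "f (Suc x) = 0"
    using calculation(2)[of "N + Suc x"] antimonoD[OF assms(2), of N "N + Suc x"] assms(3) by simp
  ultimately show ?thesis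
    by (metis not_le)
qed

lemma count_length_eq_0: "lattice w \<Longrightarrow> count_list w (length w) = 0"
proof (induction w)
  case (Cons x u)
  then have "count_list u (length u) = 0" "count_list u (Suc (length u)) = 0"
    using lattice_count_Suc_le[of u "length u"] by auto
  with Cons.prems show ?case by auto
qed simp

lemma length_eq_sum_count:
  assumes "lattice w"
  shows "length w = (\<Sum>i<length w. count_list w i)"
proof -
  have "i < length w" if "i \<in> set w" for i
  proof (rule ccontr)
    assume "\<not> i < length w"
    then have "count_list w i = 0"
      using antimonoD[OF lattice_count_antimono[OF assms], of "length w" i]
        count_length_eq_0[OF assms] by simp
    with that show False by (simp add: count_list_0_iff)
  qed
  then show ?thesis
    using sum_count_set[of w "{..<length w}"] by (simp add: subset_eq)
qed

text \<open>If no 2-minor keeps the last cell of row \<open>x\<close>, then after the removal of any other corner that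
  cell is the only corner, so the shape is a rectangle with at most one additional cell.\<close>

lemma minors2_avoiding_row:
  assumes "lattice w" "\<And>t. t \<in> set (minors2 w) \<Longrightarrow> count_list t x < count_list w x"
  shows "\<exists>b r e. e \<le> 1 \<and> (\<forall>i. count_list w i = (if i \<le> x then b else 0) + e * of_bool (i = r))"
proof (cases "\<exists>r. r \<noteq> x \<and> count_list w (Suc r) < count_list w r")
  case False
  then obtain b where "\<forall>i. count_list w i = (if i \<le> x then b else 0)"
    using only_corner_rectangle[of x "count_list w" "length w"] count_length_eq_0[OF assms(1)]
      lattice_count_antimono[OF assms(1)] by (metis not_le)
  then have "\<forall>i. count_list w i = (if i \<le> x then b else 0) + 0 * of_bool (i = x)" by simp
  then show ?thesis by (meson zero_le)
next
  case True
  then obtain r v where r: "r \<noteq> x" and v: "v \<in> set (minors w)"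
    "\<And>s. count_list w s = count_list v s + of_bool (s = r)"
    using corner_minor[OF assms(1)] by blast
  have lv: "lattice v" using minors_count assms(1) v(1) by blast
  have "count_list v s \<le> count_list v (Suc s)" if "s \<noteq> x" for s
  proof (rule ccontr)
    assume "\<not> ?thesis"
    then obtain t where t: "t \<in> set (minors v)"
      "\<And>i. count_list v i = count_list t i + of_bool (i = s)"
      using corner_minor[OF lv, of s] by auto
    have "t \<in> set (minors2 w)" using t(1) v(1) by (auto simp: minors2_def)
    from assms(2)[OF this] show False
      using v(2)[of x] t(2)[of x] r that by auto
  qed
  then obtain b where "\<forall>i. count_list v i = (if i \<le> x then b else 0)"
    using only_corner_rectangle[of x "count_list v" "length v"] count_length_eq_0[OF lv]
      lattice_count_antimono[OF lv] by blast
  with v(2) have "\<forall>i. count_list w i = (if i \<le> x then b else 0) + 1 * of_bool (i = r)" by simp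
  then show ?thesis by (meson order_refl)
qed

lemma minors2_le:
  assumes "lattice w" "t \<in> set (minors2 w)" shows "count_list t s \<le> count_list w s"
proof -
  obtain v where v: "v \<in> set (minors w)" "t \<in> set (minors v)"
    using assms by (auto simp: minors2_def)
  obtain r where "\<forall>s. count_list w s = count_list v s + of_bool (s = r)" "lattice v"
    using minors_count assms(1) v by blast
  moreover obtain r' where "\<forall>s. count_list v s = count_list t s + of_bool (s = r')"
    using minors_count calculation(2) v by blast
  ultimately show ?thesis by simp
qed

text \<open>Suppose \<open>x < y\<close>. Each shape is a rectangle, with \<open>x + 1\<close> or
  \<open>y + 1\<close> rows, plus at most one cell. Comparing row lengths leaves
  \<open>x \<le> 1\<close>, \<open>y \<le> x + 2\<close> and at most 7 cells, against
  \<open>7 \<le> length u\<close>.\<close>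

lemma last_row_determined:
  assumes lat: "lattice (x # u)" "lattice (y # u)"
    and eq: "set (minors2 (x # u)) = set (minors2 (y # u))"
    and len: "7 \<le> length u"
  shows "x = y"
proof -
  have False if "x < y" "lattice (x # u)" "lattice (y # u)"
     "set (minors2 (x # u)) = set (minors2 (y # u))" for x y
  proof -
    define f g where "f = count_list (x # u)" and "g = count_list (y # u)"
    have fg: "f i + of_bool (i = y) = g i + of_bool (i = x)" for i
      using that(1) by (simp add: f_def g_def)
    have anti: "f j \<le> f i" "g j \<le> g i" if "i \<le> j" for i j
      using lattice_count_antimono[OF \<open>lattice (x # u)\<close>] lattice_count_antimono[OF \<open>lattice (y # u)\<close>]
        that antimonoD by (auto simp only: f_def g_def)
    obtain b r e where f: "\<And>i. f i = (if i \<le> x then b else 0) + e * of_bool (i = r)" "e \<le> 1"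
    proof -
      \<comment> \<open>A 2-minor of \<open>x # u\<close> is also one of \<open>y # u\<close>, whose
        row \<open>x\<close> is shorter by one cell.\<close>
      have "count_list t x < count_list (x # u) x" if "t \<in> set (minors2 (x # u))" for t
        using minors2_le[OF \<open>lattice (y # u)\<close>, of t x] that \<open>x < y\<close> \<open>_ = set (minors2 (y # u))\<close> by simp
      from minors2_avoiding_row[OF \<open>lattice (x # u)\<close> this] that show ?thesis by (auto simp only: f_def)
    qed
    obtain c s d where g: "\<And>i. g i = (if i \<le> y then c else 0) + d * of_bool (i = s)" "d \<le> 1"
    proof -
      have "count_list t y < count_list (y # u) y" if "t \<in> set (minors2 (y # u))" for t
        using minors2_le[OF \<open>lattice (x # u)\<close>, of t y] that \<open>x < y\<close> \<open>_ = set (minors2 (y # u))\<close> by simp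
      from minors2_avoiding_row[OF \<open>lattice (y # u)\<close> this] that show ?thesis by (auto simp only: g_def)
    qed
    \<comment> \<open>The additional cell cannot lie in row \<open>x + 2\<close>, for row
      \<open>x + 1\<close> would then be empty.\<close>
    have "f (Suc (Suc x)) = 0"
      using f(1)[of "Suc (Suc x)"] f(1)[of "Suc x"] anti(1)[of "Suc x" "Suc (Suc x)"] f(2) by auto
    then have "y \<le> Suc (Suc x)"
      using fg[of "Suc (Suc x)"] fg[of y] anti(2)[of "Suc (Suc x)" y] that(1)
      by (cases "y \<le> Suc (Suc x)") auto
    then have y: "y = Suc x \<or> y = Suc (Suc x)"
      using that(1) by linarith
    \<comment> \<open>An additional cell in one of the rows \<open>1..x\<close> would make that row
      longer than row 0.\<close>
    have fb: "f i = b" if "1 \<le> i" "i \<le> x" for i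
      using f(1)[of i] f(1)[of 0] anti(1)[of 0 i] that by (auto split: if_splits)
    have gc: "g i = c" if "1 \<le> i" "i \<le> y" for i
      using g(1)[of i] g(1)[of 0] anti(2)[of 0 i] that by (auto split: if_splits)
    \<comment> \<open>For \<open>x \<ge> 2\<close>, rows 1 and \<open>x\<close> are equally long in
      either shape, but \<open>f\<close> and \<open>g\<close> agree in row 1 and differ in row
      \<open>x\<close>.\<close>
    have "x \<le> 1"
    proof (rule ccontr)
      assume "\<not> x \<le> 1"
      then show False
        using fb[of 1] fb[of x] gc[of 1] gc[of x] fg[of 1] fg[of x] that(1) by auto
    qed
    have f_Suc: "f (Suc x) \<le> 1"
      using f(1)[of "Suc x"] f(2) by (simp add: of_bool_def)
    \<comment> \<open>Row \<open>y\<close> of \<open>g\<close> has length \<open>c\<close>, one more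
      than row \<open>y\<close> of \<open>f\<close>. So \<open>c\<close> is at most 2 if
      \<open>y = x + 1\<close>, where \<open>f\<close> has at most its additional cell, and
      \<open>c\<close> is 1 if \<open>y = x + 2\<close>.\<close>
    have "c * Suc y \<le> 6"
      using y
    proof
      assume "y = Suc x"
      then have "c \<le> 2" "y \<le> 2"
        using fg[of y] gc[of y] f_Suc \<open>x \<le> 1\<close> by auto
      then show ?thesis using mult_le_mono[of c 2 "Suc y" 3] by simp
    next
      assume "y = Suc (Suc x)"
      then have "c = 1" "y \<le> 3"
        using fg[of y] gc[of y] \<open>f (Suc (Suc x)) = 0\<close> \<open>x \<le> 1\<close> by auto
      then show ?thesis by simp
    qed
    have "length (y # u) = (\<Sum>i<length (y # u). g i)"
      using length_eq_sum_count[OF \<open>lattice (y # u)\<close>] by (simp only: g_def)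
    also have "\<dots> = (\<Sum>i<length (y # u). if i \<le> y then c else 0) + (\<Sum>i<length (y # u). d * of_bool (i = s))"
      by (simp only: g(1) sum.distrib)
    also have "(\<Sum>i<length (y # u). if i \<le> y then c else 0) \<le> (\<Sum>i\<le>y. c)"
      by (simp only: sum.inter_filter[symmetric] finite_lessThan) (intro sum_mono2; auto)
    also have "(\<Sum>i<length (y # u). d * of_bool (i = s)) \<le> d"
      by (simp add: of_bool_def if_distrib[of "(*) d"] cong: if_cong)
    finally have "length (y # u) \<le> c * Suc y + d"
      by (simp add: mult.commute)
    then show False
      using \<open>c * Suc y \<le> 6\<close> g(2) len by simp
  qed
  then show ?thesis using assms by (metis nat_neq_iff)
qed

section \<open>Tableaux as words\<close>

lemma dom_fill: "lattice w \<Longrightarrow> dom (fill w) = {(i, j). j < count_list w i}"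
  by (induction w) (auto split: if_splits)

lemma fill_eq_None_iff: "lattice w \<Longrightarrow> fill w (i, j) = None \<longleftrightarrow> count_list w i \<le> j"
  using dom_fill[of w] by (metis (mono_tags, lifting) case_prod_conv domIff mem_Collect_eq not_less)

lemma ran_fill: "lattice w \<Longrightarrow> ran (fill w) = {1..length w}"
proof (induction w)
  case (Cons x u)
  then have "fill u (x, count_list u x) = None"
    by (simp add: fill_eq_None_iff)
  then have "ran (fill (x # u)) = insert (Suc (length u)) (ran (fill u))"
    by (simp add: ran_map_upd del: fun_upd_apply)
  also have "\<dots> = {1..length (x # u)}"
    using Cons by auto
  finally show ?case .
qed simp

lemma fill_SomeD: "fill w c = Some k \<Longrightarrow> 1 \<le> k \<and> k \<le> length w"
  by (induction w) (auto split: if_splits)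

lemma fill_inj: "fill w c = Some k \<Longrightarrow> fill w c' = Some k \<Longrightarrow> c = c'"
  by (induction w) (auto split: if_splits dest: fill_SomeD)

lemma fill_eq_imp_eq:
  assumes "lattice w" "lattice w'" "fill w = fill w'"
  shows "w = w'"
proof -
  have "length w = length w'"
    using ran_fill[OF assms(1)] ran_fill[OF assms(2)] assms(3)
    by (metis card_atLeastAtMost diff_Suc_1 One_nat_def)
  then show ?thesis using assms
  proof (induction w w' rule: list_induct2)
    case (Cons x u y u')
    have "fill (y # u') (x, count_list u x) = Some (Suc (length u'))"
      using Cons.prems(3) Cons.hyps by (metis fill.simps(2) fun_upd_same)
    moreover have "fill (y # u') (y, count_list u' y) = Some (Suc (length u'))"
      by simp
    ultimately have "(x, count_list u x) = (y, count_list u' y)"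
      by (rule fill_inj)
    moreover from this have "fill u = fill u'"
      using Cons.prems fill_eq_None_iff[of u x "count_list u x"] fill_eq_None_iff[of u' y "count_list u' y"]
      by (metis fill.simps(2) fun_upd_triv fun_upd_upd lattice.simps(2) order_refl)
    ultimately show ?case using Cons by auto
  qed simp
qed

text \<open>The shape appears only as a downward closed set of cells, a form suited to removing the
  largest entry. Weak monotonicity suffices, since injectivity makes it strict for distinct
  cells.\<close>

definition standard :: "nat \<Rightarrow> filling \<Rightarrow> bool" where
  "standard n T \<longleftrightarrow> ran T = {1..n} \<and> inj_on T (dom T) \<and>
     (\<forall>i j i' j'. i' \<le> i \<longrightarrow> j' \<le> j \<longrightarrow> (i, j) \<in> dom T \<longrightarrow> (i', j') \<in> dom T) \<and>
     (\<forall>i j i' j' a b. i \<le> i' \<longrightarrow> j \<le> j' \<longrightarrow> T (i, j) = Some a \<longrightarrow> T (i', j') = Some b \<longrightarrow> a \<le> b)"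

lemma YT_standard:
  assumes "T \<in> YT n"
  shows "standard n T"
proof -
  obtain p where p: "is_partition n p" "tableau_of_shape p T" "ran T = {1..n}"
    using assms by (auto simp: YT_def)
  have dom: "dom T = young_diagram p" using p by (auto simp: tableau_of_shape_def)
  have row: "a \<le> b" if "j \<le> j'" "T (i, j) = Some a" "T (i, j') = Some b" for i j j' a b
  proof (cases "j = j'")
    case False
    then have "a < b"
      using p(2) that unfolding tableau_of_shape_def by (meson le_neq_implies_less)
    then show ?thesis by simp
  qed (use that in simp)
  have col: "a \<le> b" if "i \<le> i'" "T (i, j) = Some a" "T (i', j) = Some b" for i i' j a b
  proof (cases "i = i'")
    case False
    then have "a < b"
      using p(2) that unfolding tableau_of_shape_def by (meson le_neq_implies_less)
    then show ?thesis by simp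
  qed (use that in simp)
  have down: "(i', j') \<in> dom T" if "i' \<le> i" "j' \<le> j" "(i, j) \<in> dom T" for i j i' j'
  proof -
    have "p ! i \<le> p ! i'" if "i < length p"
      using p(1) that \<open>i' \<le> i\<close> sorted_wrt_nth_less[of "(\<ge>)" p i' i]
      by (cases "i = i'") (auto simp: is_partition_def)
    with that show ?thesis by (auto simp: dom young_diagram_def)
  qed
  have "a \<le> b" if "i \<le> i'" "j \<le> j'" "T (i, j) = Some a" "T (i', j') = Some b" for i j i' j' a b
  proof -
    have "(i, j') \<in> dom T"
      using down[OF \<open>i \<le> i'\<close> order_refl] that(4) by blast
    then obtain k where "T (i, j') = Some k" by auto
    then show ?thesis using row col that by (meson order_trans)
  qed
  moreover have "inj_on T (dom T)"
    using p(2) unfolding tableau_of_shape_def by blast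
  ultimately show ?thesis
    using p(3) down unfolding standard_def by blast
qed

text \<open>Removing the largest entry leaves a standard filling, and the row of that entry is the
  letter to put in front of the word of the rest.\<close>

lemma standard_eq_fill:
  assumes "standard n T"
  shows "\<exists>w. lattice w \<and> length w = n \<and> fill w = T"
  using assms
proof (induction n arbitrary: T)
  case 0
  then have "ran T = {}" unfolding standard_def by simp
  then have "T = Map.empty" by (auto simp: ran_def fun_eq_iff) (metis option.exhaust)
  then show ?case by (intro exI[of _ "[]"]) simp
next
  case (Suc n)
  have ran: "ran T = {1..Suc n}" and inj: "inj_on T (dom T)"
    using Suc.prems unfolding standard_def by blast+
  then have "Suc n \<in> ran T" by simp
  then obtain x y where xy: "T (x, y) = Some (Suc n)" by (auto simp: ran_def)
  have unique: "c = (x, y)" if "T c = Some (Suc n)" for c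
    using that xy inj_onD[OF inj, of c "(x, y)"] by auto
  have down: "(i', j') \<in> dom T" if "i' \<le> i" "j' \<le> j" "(i, j) \<in> dom T" for i j i' j'
    using Suc.prems that unfolding standard_def by blast
  have mono: "a \<le> b" if "i \<le> i'" "j \<le> j'" "T (i, j) = Some a" "T (i', j') = Some b" for i j i' j' a b
    using Suc.prems that unfolding standard_def by blast
  have bound: "b \<le> Suc n" if "T c = Some b" for b c
    using ran ranI[of T c b, OF that] by auto
  define T' where "T' = T((x, y) := None)"
  have "ran T' = {1..n}"
  proof (intro equalityI subsetI)
    fix k assume "k \<in> ran T'"
    then obtain c where c: "T c = Some k" "c \<noteq> (x, y)"
      by (auto simp: ran_def T'_def split: if_splits)
    moreover have "k \<in> {1..Suc n}" using c(1) ranI[of T c k] ran by auto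
    ultimately show "k \<in> {1..n}" using unique[of c] by (auto simp: le_Suc_eq)
  next
    fix k assume k: "k \<in> {1..n}"
    then have "k \<in> ran T" using ran by auto
    then obtain c where "T c = Some k" by (auto simp: ran_def)
    then have "T' c = Some k" using xy k by (auto simp: T'_def)
    then show "k \<in> ran T'" by (rule ranI)
  qed
  moreover have "inj_on T' (dom T')"
    using inj by (auto simp: T'_def inj_on_def domIff)
  moreover have "(i', j') \<in> dom T'" if le: "i' \<le> i" "j' \<le> j" and ij: "(i, j) \<in> dom T'" for i j i' j'
  proof -
    obtain b where b: "T (i, j) = Some b" "(i, j) \<noteq> (x, y)"
      using ij by (auto simp: T'_def split: if_splits)
    have "(i', j') \<noteq> (x, y)"
    proof
      assume "(i', j') = (x, y)"
      then have "b = Suc n"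
        using mono[of i' i j' j "Suc n" b] bound[of "(i, j)" b] le xy b by auto
      with b unique show False by blast
    qed
    moreover have "(i', j') \<in> dom T"
      using down[OF le] b by auto
    ultimately show ?thesis by (auto simp: T'_def)
  qed
  moreover have "a \<le> b" if "i \<le> i'" "j \<le> j'" "T' (i, j) = Some a" "T' (i', j') = Some b" for i j i' j' a b
  proof -
    have "T (i, j) = Some a" "T (i', j') = Some b"
      using that by (auto simp: T'_def split: if_splits)
    with mono that(1,2) show ?thesis by blast
  qed
  ultimately have "standard n T'"
    unfolding standard_def by blast
  then obtain u where u: "lattice u" "length u = n" "fill u = T'" using Suc.IH by blast
  have dom': "(i, j) \<in> dom T' \<longleftrightarrow> j < count_list u i" for i j
    using dom_fill[OF u(1)] u(3) by auto
  have "y = count_list u x"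
  proof (rule antisym)
    show "count_list u x \<le> y"
      using dom'[of x y] by (auto simp: T'_def)
    show "y \<le> count_list u x"
    proof (rule ccontr)
      assume "\<not> ?thesis"
      then have "(x, count_list u x) \<in> dom T'"
        using down[of x x "count_list u x" y] xy by (auto simp: T'_def)
      then show False using dom' by auto
    qed
  qed
  moreover have "y < count_list u (x - 1)" if "x \<noteq> 0"
    using that down[of "x - 1" x y y] xy dom'[of "x - 1" y] by (auto simp: T'_def)
  ultimately show ?case
    using u xy by (intro exI[of _ "x # u"]) (auto simp: T'_def)
qed

section \<open>Slides\<close>

text \<open>A relational form of \<open>jdt\<close> that also records the cell where the empty space
  ends; rule induction on its derivations takes the place of a termination argument.\<close>

inductive slide :: "filling \<Rightarrow> cell \<Rightarrow> filling \<Rightarrow> cell \<Rightarrow> bool" where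
  stop: "T (i, Suc j) = None \<Longrightarrow> T (Suc i, j) = None \<Longrightarrow> slide T (i, j) T (i, j)"
| right: "T (i, Suc j) = Some a \<Longrightarrow> (\<And>b. T (Suc i, j) = Some b \<Longrightarrow> a < b) \<Longrightarrow>
    slide (T((i, j) := Some a, (i, Suc j) := None)) (i, Suc j) T' h \<Longrightarrow> slide T (i, j) T' h"
| down: "T (Suc i, j) = Some b \<Longrightarrow> (\<And>a. T (i, Suc j) = Some a \<Longrightarrow> \<not> a < b) \<Longrightarrow>
    slide (T((i, j) := Some b, (Suc i, j) := None)) (Suc i, j) T' h \<Longrightarrow> slide T (i, j) T' h"

lemma slide_jdt: "slide T (i, j) T' h \<Longrightarrow> jdt T i j = T'"
proof (induction T "(i, j)" T' h arbitrary: i j rule: slide.induct)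
  case (stop T i j)
  then show ?case by (subst jdt.simps) simp
next
  case (right T i j a T' h)
  then show ?case by (subst jdt.simps) (auto split: option.split)
next
  case (down T i j b T' h)
  then show ?case by (subst jdt.simps) (auto split: option.split)
qed

text \<open>A new largest entry at an outer cell is never preferred to another candidate, so it can only take
  part in a slide after the slide of the other entries has ended.\<close>

lemma slide_add_max:
  assumes "slide T p T' h" "T d = None" "d \<noteq> p" "\<And>c a. T c = Some a \<Longrightarrow> a < N"
    and "slide (T'(d \<mapsto> N)) h T'' h'"
  shows "slide (T(d \<mapsto> N)) p T'' h'"
  using assms
proof (induction arbitrary: rule: slide.induct)
  case (stop T i j)
  then show ?case by simp
next
  case (right T i j a T' h)
  then have d: "d \<noteq> (i, Suc j)" by auto
  have "slide ((T((i, j) := Some a, (i, Suc j) := None))(d \<mapsto> N)) (i, Suc j) T'' h'"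
    using right d by (intro right.IH) (auto split: if_splits)
  also have "(T((i, j) := Some a, (i, Suc j) := None))(d \<mapsto> N) =
      (T(d \<mapsto> N))((i, j) := Some a, (i, Suc j) := None)"
    using d right.prems by auto
  finally show ?case
    by (rule slide.right[rotated 2]) (use d right in \<open>auto split: if_splits\<close>)
next
  case (down T i j b T' h)
  then have d: "d \<noteq> (Suc i, j)" by auto
  have "slide ((T((i, j) := Some b, (Suc i, j) := None))(d \<mapsto> N)) (Suc i, j) T'' h'"
    using down d by (intro down.IH) (auto split: if_splits)
  also have "(T((i, j) := Some b, (Suc i, j) := None))(d \<mapsto> N) =
      (T(d \<mapsto> N))((i, j) := Some b, (Suc i, j) := None)"
    using d down.prems by auto
  finally show ?case
    by (rule slide.down[rotated 2]) (use d down in \<open>auto dest: less_asym split: if_splits\<close>)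
qed

text \<open>Together with \<open>slide_down_stop\<close>, this continues a slide that ended at
  \<open>(i, j)\<close> before \<open>N\<close> was added: \<open>N\<close> moves into the empty
  space and the slide ends.\<close>

lemma slide_right_stop:
  assumes "T (i, Suc j) = None" "T (Suc i, j) = None"
    "T (i, Suc (Suc j)) = None" "T (Suc i, Suc j) = None"
  shows "slide (T((i, Suc j) \<mapsto> N)) (i, j) (T((i, j) \<mapsto> N)) (i, Suc j)"
proof -
  have "slide (T((i, j) \<mapsto> N)) (i, Suc j) (T((i, j) \<mapsto> N)) (i, Suc j)"
    by (rule slide.stop) (use assms in simp_all)
  moreover have "(T((i, Suc j) \<mapsto> N))((i, j) \<mapsto> N, (i, Suc j) := None) = T((i, j) \<mapsto> N)"
    using assms(1) by (simp add: fun_eq_iff)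
  ultimately show ?thesis
    using assms(2) by (intro slide.right[of _ i j N]) simp_all
qed

lemma slide_down_stop:
  assumes "T (i, Suc j) = None" "T (Suc i, j) = None"
    "T (Suc i, Suc j) = None" "T (Suc (Suc i), j) = None"
  shows "slide (T((Suc i, j) \<mapsto> N)) (i, j) (T((i, j) \<mapsto> N)) (Suc i, j)"
proof -
  have "slide (T((i, j) \<mapsto> N)) (Suc i, j) (T((i, j) \<mapsto> N)) (Suc i, j)"
    by (rule slide.stop) (use assms in simp_all)
  moreover have "(T((Suc i, j) \<mapsto> N))((i, j) \<mapsto> N, (Suc i, j) := None) = T((i, j) \<mapsto> N)"
    using assms(2) by (simp add: fun_eq_iff)
  ultimately show ?thesis
    using assms(1) by (intro slide.down[of _ i j N]) simp_all
qed

definition relabel :: "nat \<Rightarrow> filling \<Rightarrow> filling" where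
  "relabel m T = (\<lambda>c. map_option (\<lambda>k. if m < k then k - 1 else k) (T c))"

lemma relabel_upd: "relabel m (T(c \<mapsto> k)) = (relabel m T)(c \<mapsto> if m < k then k - 1 else k)"
  by (auto simp: relabel_def)

text \<open>Induction on the word, adding the largest entry last: by \<open>slide_add_max\<close>
  the slide in \<open>u\<close> runs first, vacating the end of row \<open>r\<close>, and the new
  entry moves only if it is adjacent to that cell. Moving up is the case in which
  \<open>push\<close> lowers the letter; moving left keeps its row.\<close>

lemma slide_minor:
  assumes "lattice w" "i < length w"
  shows "\<exists>c T' r. fill w c = Some (length w - i) \<and>
    slide ((fill w)(c := None)) c T' (r, count_list (minors w ! i) r) \<and>
    relabel (length w - i) T' = fill (minors w ! i) \<and>
    (\<forall>s. count_list w s = count_list (minors w ! i) s + of_bool (s = r))"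
  using assms
proof (induction w arbitrary: i)
  case (Cons x u)
  show ?case
  proof (cases i)
    case 0
    let ?c = "(x, count_list u x)"
    have lat: "lattice u" using Cons.prems by simp
    then have u: "(fill (x # u))(?c := None) = fill u"
      using fill_eq_None_iff[of u x "count_list u x"] by auto
    have "slide (fill u) ?c (fill u) ?c"
      using lat lattice_count_Suc_le[OF lat, of x] by (intro slide.stop) (auto simp: fill_eq_None_iff)
    moreover have "relabel (Suc (length u)) (fill u) c = fill u c" for c
      by (cases "fill u c") (auto simp: relabel_def dest: fill_SomeD)
    ultimately show ?thesis
      using 0 u by (intro exI[of _ ?c] exI[of _ "fill u"] exI[of _ x]) (auto simp del: fill.simps(2), simp)
  next
    case (Suc i')
    let ?v = "minors u ! i'" and ?d = "(x, count_list u x)" and ?N = "Suc (length u)"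
    let ?m = "length u - i'"
    have lat: "lattice u" and i': "i' < length u" using Cons.prems Suc by auto
    obtain c T' r where c: "fill u c = Some ?m"
      and slide: "slide ((fill u)(c := None)) c T' (r, count_list ?v r)"
      and relabel: "relabel ?m T' = fill ?v"
      and count: "\<And>s. count_list u s = count_list ?v s + of_bool (s = r)"
      using Cons.IH[OF lat i'] by blast
    have v_in: "?v \<in> set (minors u)" using i' by (simp add: length_minors)
    have v: "lattice ?v" "Suc (length ?v) = length u"
      using minors_count[OF lat v_in] by auto
    have nth: "minors (x # u) ! i = push x ?v"
      using i' by (simp add: Suc length_minors)
    have T'_None: "T' (p, q) = None \<longleftrightarrow> count_list ?v p \<le> q" for p q
      using fun_cong[OF relabel, of "(p, q)"] fill_eq_None_iff[OF v(1), of p q]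
      by (auto simp: relabel_def)
    have d_None: "fill u ?d = None" using fill_eq_None_iff[OF lat] by simp
    then have "c \<noteq> ?d" using c by auto
    then have w: "(fill (x # u))(c := None) = ((fill u)(c := None))(?d \<mapsto> ?N)"
      by (simp add: fun_upd_twist)
    have c': "fill (x # u) c = Some (length (x # u) - i)"
      using c \<open>c \<noteq> ?d\<close> Suc by simp
    have slideI: "slide ((fill (x # u))(c := None)) c T'' h'"
      if "slide (T'(?d \<mapsto> ?N)) (r, count_list ?v r) T'' h'" for T'' h'
      unfolding w using slide _ _ _ that
    proof (rule slide_add_max)
      show "a < ?N" if "((fill u)(c := None)) p = Some a" for p a
        using that fill_SomeD[of u p a] by (auto split: if_splits)
    qed (use d_None \<open>c \<noteq> ?d\<close> in auto)
    \<comment> \<open>\<open>?N\<close> exceeds \<open>?m\<close>, so it is lowered to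
      \<open>length u\<close>, which is the entry that \<open>fill\<close> gives to a letter in
      front of \<open>?v\<close>.\<close>
    have relabel_max: "relabel ?m (T'(p \<mapsto> ?N)) = (fill ?v)(p \<mapsto> length u)" for p
      using relabel by (simp add: relabel_upd less_Suc_eq_le)
    have neighbours: "count_list ?v (Suc r) \<le> count_list ?v r"
      using lattice_count_Suc_le[OF v(1)] .
    have result: ?thesis
      if "slide (T'(?d \<mapsto> ?N)) (r, count_list ?v r) (T'((y, count_list ?v y) \<mapsto> ?N)) (z, count_list (y # ?v) z)"
        "push x ?v = y # ?v" "\<And>s. count_list (x # u) s = count_list (y # ?v) s + of_bool (s = z)" for y z
    proof (intro exI conjI)
      show "slide ((fill (x # u))(c := None)) c (T'((y, count_list ?v y) \<mapsto> ?N))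
          (z, count_list (minors (x # u) ! i) z)"
        using slideI[OF that(1)] nth that(2) by simp
      have "fill (y # ?v) = (fill ?v)((y, count_list ?v y) \<mapsto> length u)"
        using v(2) by simp
      with relabel_max show "relabel (length (x # u) - i) (T'((y, count_list ?v y) \<mapsto> ?N)) = fill (minors (x # u) ! i)"
        using nth that(2) Suc by simp
      show "\<forall>s. count_list (x # u) s = count_list (minors (x # u) ! i) s + of_bool (s = z)"
        using that(2,3) nth by simp
    qed (use c' in simp)
    show ?thesis
      using Cons.prems(1) v(1) count
    proof (cases rule: lattice_pushI)
      case 1
      have d: "?d = (Suc r, count_list ?v r)" using 1 by simp
      have "T' (r, Suc (count_list ?v r)) = None" "T' (Suc r, Suc (count_list ?v r)) = None"
        "T' (Suc (Suc r), count_list ?v r) = None" "T' ?d = None"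
        using neighbours lattice_count_Suc_le[OF v(1), of "Suc r"] by (auto simp: T'_None d)
      then have "slide (T'(?d \<mapsto> ?N)) (r, count_list ?v r) (T'((r, count_list ?v r) \<mapsto> ?N)) ?d"
        unfolding d by (intro slide_down_stop)
      moreover have "?d = (x, count_list (r # ?v) x)"
        using 1(1) count[of x] by simp
      ultimately have "slide (T'(?d \<mapsto> ?N)) (r, count_list ?v r) (T'((r, count_list ?v r) \<mapsto> ?N))
          (x, count_list (r # ?v) x)"
        by (simp only:)
      then show ?thesis
        using 1(3) by (rule result) (use 1(1) count in auto)
    next
      case 2
      show ?thesis
      proof (cases "x = r")
        case True
        have d: "?d = (r, Suc (count_list ?v r))" using True count[of r] by simp
        have "T' (r, Suc (Suc (count_list ?v r))) = None" "T' (Suc r, Suc (count_list ?v r)) = None"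
          "T' (Suc r, count_list ?v r) = None" "T' ?d = None"
          using neighbours by (auto simp: T'_None d)
        then have "slide (T'(?d \<mapsto> ?N)) (r, count_list ?v r) (T'((r, count_list ?v r) \<mapsto> ?N)) ?d"
          unfolding d by (intro slide_right_stop)
        moreover have "?d = (r, count_list (x # ?v) r)"
          using True count[of x] by simp
        ultimately have "slide (T'(?d \<mapsto> ?N)) (r, count_list ?v r) (T'((x, count_list ?v x) \<mapsto> ?N))
            (r, count_list (x # ?v) r)"
          using True by (simp only:)
        then show ?thesis
          using 2(2) by (rule result) (use count in auto)
      next
        case False
        then have d: "?d = (x, count_list ?v x)" using count[of x] by simp
        have "T' (r, Suc (count_list ?v r)) = None" "T' (Suc r, count_list ?v r) = None"
          using neighbours by (auto simp: T'_None)
        moreover have "?d \<noteq> (r, Suc (count_list ?v r))" "?d \<noteq> (Suc r, count_list ?v r)"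
          using False 2(1) by auto
        ultimately have "slide (T'(?d \<mapsto> ?N)) (r, count_list ?v r) (T'(?d \<mapsto> ?N)) (r, count_list ?v r)"
          by (intro slide.stop) (metis fun_upd_other)+
        then have "slide (T'(?d \<mapsto> ?N)) (r, count_list ?v r) (T'((x, count_list ?v x) \<mapsto> ?N))
            (r, count_list (x # ?v) r)"
          using False d by simp
        then show ?thesis
          using 2(2) by (rule result) (use count in auto)
      qed
    qed
  qed
qed simp

section \<open>Deletions and 2-minors of fillings in terms of words\<close>

lemma delete_entry_fill:
  assumes "lattice w" "i < length w"
  shows "delete_entry (fill w) (length w - i) = fill (minors w ! i)"
proof -
  obtain p q T' h where c: "fill w (p, q) = Some (length w - i)"
    and T': "slide ((fill w)((p, q) := None)) (p, q) T' h"
      "relabel (length w - i) T' = fill (minors w ! i)"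
    using slide_minor[OF assms] by (metis surj_pair)
  have "(THE c. fill w c = Some (length w - i)) = (p, q)"
    using c fill_inj by (intro the_equality) blast+
  then show ?thesis
    using slide_jdt[OF T'(1)] T'(2) by (simp add: delete_entry_def relabel_def)
qed

lemma deletions_fill:
  assumes "lattice w"
  shows "delete_entry (fill w) ` ran (fill w) = fill ` set (minors w)"
proof -
  have "k \<in> (\<lambda>i. length w - i) ` {..<length w}" if "k \<in> {1..length w}" for k
    using that by (intro image_eqI[of _ _ "length w - k"]) auto
  then have "ran (fill w) = (\<lambda>i. length w - i) ` {..<length w}"
    unfolding ran_fill[OF assms] by fastforce
  then have "delete_entry (fill w) ` ran (fill w) = (\<lambda>i. fill (minors w ! i)) ` {..<length w}"
    using delete_entry_fill[OF assms] by (simp add: image_image)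
  also have "\<dots> = fill ` (\<lambda>i. minors w ! i) ` {..<length w}"
    by (simp only: image_image)
  also have "(\<lambda>i. minors w ! i) ` {..<length w} = set (minors w)"
    using nth_image[of "length w" "minors w"] by (simp add: length_minors atLeast0LessThan)
  finally show ?thesis .
qed

lemma M2_fill:
  assumes "lattice w"
  shows "M2 (fill w) = fill ` set (minors2 w)"
proof -
  have "M2 (fill w) = (\<Union>T \<in> delete_entry (fill w) ` ran (fill w). delete_entry T ` ran T)"
    by (auto simp: M2_def)
  also have "\<dots> = (\<Union>v\<in>set (minors w). delete_entry (fill v) ` ran (fill v))"
    by (simp add: deletions_fill[OF assms])
  also have "\<dots> = (\<Union>v\<in>set (minors w). fill ` set (minors v))"
    using minors_count[OF assms] by (simp add: deletions_fill)
  finally show ?thesis by (simp add: minors2_def image_UN)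
qed

text \<open>\<open>fill\<close> is injective on lattice words, so sets of 2-minors can be compared
  as sets of words.\<close>

lemma M2_fill_eq_iff:
  assumes "lattice w" "lattice w'"
  shows "M2 (fill w) = M2 (fill w') \<longleftrightarrow> set (minors2 w) = set (minors2 w')"
proof -
  have "lattice t" if "lattice w" "t \<in> set (minors2 w)" for t w
    using that minors_count by (auto simp: minors2_def)
  then have "inj_on fill (set (minors2 w) \<union> set (minors2 w'))"
    using assms fill_eq_imp_eq by (intro inj_onI) blast
  then show ?thesis
    using assms by (simp add: M2_fill inj_on_Un_image_eq_iff)
qed

section \<open>Words of length 8\<close>

text \<open>The duplicates are removed at every level because \<open>classes_8\<close> below is proved by rewriting.\<close>

fun dminors :: "nat list \<Rightarrow> nat list list" where
  "dminors [] = []"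
| "dminors (x # u) = List.insert u (remdups (map (push x) (dminors u)))"

definition dminors2 :: "nat list \<Rightarrow> nat list list" where
  "dminors2 w = remdups (concat (map dminors (dminors w)))"

lemma set_dminors: "set (dminors w) = set (minors w)"
  by (induction w) auto

lemma set_dminors2: "set (dminors2 w) = set (minors2 w)"
  by (simp add: dminors2_def minors2_def set_dminors)

text \<open>A letter \<open>Suc y\<close> can be added to \<open>u\<close> only if \<open>y\<close>
  occurs in \<open>u\<close>, so these finitely many candidates include every lattice
  extension.\<close>

definition children :: "nat list \<Rightarrow> nat list list" where
  "children u = filter lattice (map (\<lambda>x. x # u) (remdups (0 # map Suc u)))"

function group :: "('a \<times> 'b list) list \<Rightarrow> ('a \<times> 'b list) list list" where
  "group [] = []"
| "group (p # ps) = (case partition (\<lambda>q. set (snd p) = set (snd q)) ps of (A, B) \<Rightarrow> (p # A) # group B)"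
  by pat_completeness auto
termination
  by (relation "measure length") (auto simp: le_imp_less_Suc)

text \<open>Words with equal sets of 2-minors share a class; by \<open>tl_minors2\<close>, only words whose tails
  share a class need to be compared.\<close>

primrec classes :: "nat \<Rightarrow> nat list list list" where
  "classes 0 = [[[]]]"
| "classes (Suc n) = concat (map (\<lambda>C. map (map fst)
     (group (map (\<lambda>w. (w, dminors2 w)) (concat (map children C))))) (classes n))"

lemma group_same:
  assumes "p \<in> set ps" "q \<in> set ps" "set (snd p) = set (snd q)"
  shows "\<exists>G\<in>set (group ps). p \<in> set G \<and> q \<in> set G"
  using assms
proof (induction ps rule: group.induct)
  case (2 r ps)
  show ?case
  proof (cases "set (snd r) = set (snd p)")
    case True
    then show ?thesis using 2 by auto
  next
    case False
    then show ?thesis using 2 by fastforce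
  qed
qed simp

lemma in_children:
  assumes "lattice (x # u)"
  shows "x # u \<in> set (children u)"
proof -
  have "x = 0 \<or> x \<in> Suc ` set u"
  proof (cases x)
    case (Suc y)
    then have "count_list u y \<noteq> 0" using assms by simp
    then have "y \<in> set u" by (simp add: count_list_0_iff)
    then show ?thesis using Suc by simp
  qed simp
  then show ?thesis
    using assms by (auto simp: children_def)
qed

lemma classes_same:
  assumes "length u = n" "length v = n" "lattice u" "lattice v" "set (minors2 u) = set (minors2 v)"
  shows "\<exists>C\<in>set (classes n). u \<in> set C \<and> v \<in> set C"
  using assms
proof (induction n arbitrary: u v)
  case (Suc n)
  obtain x u' y v' where uv: "u = x # u'" "v = y # v'"
    using Suc.prems by (metis length_Suc_conv)
  have lat: "lattice u'" "lattice v'" and len: "length u' = n" "length v' = n"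
    using Suc.prems uv by auto
  have "set (minors2 u') = set (minors2 v')"
  proof (cases "2 \<le> n")
    case True
    then show ?thesis
      using tl_minors2[of u' x] tl_minors2[of v' y] lat len uv Suc.prems(5) by simp
  next
    \<comment> \<open>Below the range of \<open>tl_minors2\<close> there is only one lattice word of
      each length.\<close>
    case False
    have "w = replicate n 0" if "lattice w" "length w = n" for w
      using that False by (cases w) (auto simp: not_less_eq_eq)
    then have "u' = v'"
      using lat len by metis
    then show ?thesis by simp
  qed
  then obtain C where C: "C \<in> set (classes n)" "u' \<in> set C" "v' \<in> set C"
    using Suc.IH lat len by blast
  let ?ps = "map (\<lambda>w. (w, dminors2 w)) (concat (map children C))"
  have "u \<in> set (concat (map children C))" "v \<in> set (concat (map children C))"
    using C in_children Suc.prems uv by auto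
  then have in_ps: "(u, dminors2 u) \<in> set ?ps" "(v, dminors2 v) \<in> set ?ps"
    by auto
  obtain G where G: "G \<in> set (group ?ps)" "(u, dminors2 u) \<in> set G" "(v, dminors2 v) \<in> set G"
    using group_same[OF in_ps] Suc.prems(5) by (auto simp: set_dminors2)
  have "map fst G \<in> set (classes (Suc n))"
    using C(1) G(1) by (auto intro!: bexI[of _ C])
  moreover have "u \<in> set (map fst G)" "v \<in> set (map fst G)"
    using G by force+
  ultimately show ?case by blast
qed simp

text \<open>With \<open>classes_same\<close>, singleton classes mean that distinct lattice words of
  length 8 have different sets of 2-minors.\<close>

lemma classes_8: "list_all (\<lambda>C. length C = 1) (classes 8)"
  by code_simp

section \<open>Induction on the number of entries\<close>

lemma minors2_inj:
  assumes "8 \<le> n" "length u = n" "length v = n" "lattice u" "lattice v" "set (minors2 u) = set (minors2 v)"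
  shows "u = v"
  using assms
proof (induction n arbitrary: u v rule: nat_induct_at_least)
  case base
  then obtain C where "C \<in> set (classes 8)" "u \<in> set C" "v \<in> set C"
    using classes_same[of u 8 v] by auto
  moreover from this obtain c where "C = [c]"
    using classes_8 by (auto simp: list_all_iff length_Suc_conv)
  ultimately show ?case by simp
next
  case (Suc n)
  obtain x u' y v' where uv: "u = x # u'" "v = y # v'"
    using Suc.prems by (metis length_Suc_conv)
  have "set (minors2 u') = set (minors2 v')"
    using tl_minors2[of u' x] tl_minors2[of v' y] Suc.hyps Suc.prems uv by simp
  then have "u' = v'"
    using Suc.IH Suc.prems uv by simp
  with last_row_determined[of x u' y] show ?case
    using Suc.hyps Suc.prems uv by simp
qed

theorem theorem6p1:
  fixes n :: nat and S T :: filling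
  assumes "n \<ge> 8"
    and "S \<in> YT n" and "T \<in> YT n"
    and "M2 S = M2 T"
  shows "S = T"
proof -
  obtain u v where "lattice u" "length u = n" "fill u = S" "lattice v" "length v = n" "fill v = T"
    using standard_eq_fill[OF YT_standard] assms(2,3) by meson
  then show ?thesis
    using assms(1,4) minors2_inj[of n u v] M2_fill_eq_iff[of u v] by simp
qed

end
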